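(* Let $d\ge3$ be an odd integer and $m,l\in\mathbb N_0$ such that $l\le m$ and $m+l$ is even. Then the singular values $\lambda_{m,l,d}$ satisfy $$\lambda_{m,l,d}\le 2^{\frac{d+1}{4}}\,\pi^{\frac{d-1}{4}}\,\sqrt{C_d\,(d-2)!!}\;\sqrt{\frac{l+1}{2m+d}}\le(2\pi)^{\frac{d-1}{4}}\sqrt{C_d\,(d-2)!!},$$ where $$C_d=\begin{cases}\pi,&d=3,\\ \dfrac{d}{((d-2)!!)^2},&d\ge5.\end{cases}$$ In particular, $\lim_{m\to\infty}\lambda_{m,l,d}=0$ for every $l\in\mathbb N_0$ (limit over $m$ with $m+l$ even).
   Context: The numbers $\lambda_{m,l,d}$ (singular values of the odd part $\mathcal D^{(\mathrm{odd})}\colon L^2(\mathbb B^d)\to L^2(\mathbb S^{d-1}\times\mathbb S^{d-1})$ of the cone-beam transform $\mathcal Df(a,\omega)=\int_0^\infty f(a+t\omega)\,dt$ with sources on the sphere) are given by $$\lambda_{m,l,d}=\sqrt{\frac{N_{m+1,d}\,\mu_{m,d}^2\,|\mathbb S^{d-2}|}{|\mathbb S^{d-1}|^2}\;\sum_{n=m+1-l,\ n\text{ odd}}^{m+1+l}\nu_{n,d}^2\,N_{n,d}\,\int_{-1}^1P_{m+1,d}(t)\,P_{l,d}(t)\,P_{n,d}(t)\,(1-t^2)^{\frac{d-3}{2}}\,dt},$$ where - $|\mathbb S^{d-1}|=2\pi^{d/2}/\Gamma(d/2)$; - $N_{n,d}=\frac{(2n+d-2)(n+d-3)!}{n!(d-2)!}$;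 - $\mu_{m,d}=\sqrt{\frac{2^{d+1}\pi^{d-1}}{2m+d}}$ and $\nu_{n,d}=\frac{(-1)^{\frac{n+1}{2}}(n-1)!!}{(n+d-3)!!}$; - $P_{n,d}(t)=(-1)^n\frac{(d-3)!!}{(2n+d-3)!!}(1-t^2)^{\frac{3-d}{2}}\left(\frac{d}{dt}\right)^n(1-t^2)^{n+\frac{d-3}{2}}$ is the Legendre polynomial of degree $n$ in dimension $d$ (so $P_{n,d}(1)=1$). Double factorials: $n!!=n(n-2)\cdots$ down to $2$ or $1$, with $0!!=1$. *)

theory Defs
  imports "HOL-Analysis.Analysis"
begin

fun double_fact :: "nat \<Rightarrow> nat" where
  "double_fact 0 = 1"
| "double_fact (Suc 0) = 1"
| "double_fact (Suc (Suc n)) = Suc (Suc n) * double_fact n"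

text \<open>Surface area of the sphere of dimension \<open>k\<close>, i.e. of the unit sphere in
  Euclidean space of dimension \<open>k + 1\<close>.\<close>
definition sphere_area :: "nat \<Rightarrow> real" where
  "sphere_area k = 2 * pi powr ((real k + 1) / 2) / Gamma ((real k + 1) / 2)"

text \<open>In the rest of the theory \<open>d \<ge> 3\<close> is the dimension of the ball, so the
  subtractions on natural numbers below do not truncate.\<close>

definition harm_dim :: "nat \<Rightarrow> nat \<Rightarrow> real" where
  "harm_dim n d = real (2 * n + d - 2) * fact (n + d - 3) / (fact n * fact (d - 2))"

definition mu :: "nat \<Rightarrow> nat \<Rightarrow> real" where
  "mu m d = sqrt (2 ^ (d + 1) * pi ^ (d - 1) / real (2 * m + d))"

text \<open>Only meaningful for odd \<open>n\<close>.\<close>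
definition nu :: "nat \<Rightarrow> nat \<Rightarrow> real" where
  "nu n d = (- 1) ^ ((n + 1) div 2) * real (double_fact (n - 1)) / real (double_fact (n + d - 3))"

text \<open>The Legendre polynomial of degree \<open>n\<close> in dimension \<open>d\<close>, given by the Rodrigues
  formula. It is the intended polynomial for \<open>-1 < t < 1\<close> only; at \<open>t = 1\<close> and \<open>t = -1\<close>
  the formula has to be read as a limit, and the values of \<open>legendre_dim\<close> at these
  two points need not agree with the polynomial. It is only used under an integral
  over \<open>{-1..1}\<close>.\<close>
definition legendre_dim :: "nat \<Rightarrow> nat \<Rightarrow> real \<Rightarrow> real" where
  "legendre_dim n d t =
     (- 1) ^ n * real (double_fact (d - 3)) / real (double_fact (2 * n + d - 3))
     * (1 - t\<^sup>2) powr ((3 - real d) / 2)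
     * (deriv ^^ n) (\<lambda>s. (1 - s\<^sup>2) powr (real n + (real d - 3) / 2)) t"

text \<open>The singular values of the odd part of the cone-beam transform
  \<open>f \<mapsto> ((a, \<omega>) \<mapsto> \<integral>\<^sub>0\<^sup>\<infinity> f (a + t \<omega>) dt)\<close> from the unit ball to pairs of points of
  its boundary sphere, defined through their closed formula, for \<open>l \<le> m\<close> and
  \<open>m + l\<close> even.\<close>
definition sing_val :: "nat \<Rightarrow> nat \<Rightarrow> nat \<Rightarrow> real" where
  "sing_val m l d =
     sqrt (harm_dim (m + 1) d * (mu m d)\<^sup>2 * sphere_area (d - 2) / (sphere_area (d - 1))\<^sup>2
       * (\<Sum>n | n \<in> {m + 1 - l..m + 1 + l} \<and> odd n.
            (nu n d)\<^sup>2 * harm_dim n d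
            * integral {-1..1} (\<lambda>t. legendre_dim (m + 1) d t * legendre_dim l d t
                * legendre_dim n d t * (1 - t\<^sup>2) powr ((real d - 3) / 2))))"

definition C_const :: "nat \<Rightarrow> real" where
  "C_const d = (if d = 3 then pi else real d / (real (double_fact (d - 2)))\<^sup>2)"

end

theory Submission
  imports Defs
begin

text \<open>Write \<open>d = 2 * e + 3\<close>, so that the weight \<open>(1 - t\<^sup>2) ^ e\<close> is a polynomial. Let \<open>P\<^sub>n\<close> be
  the Legendre polynomials of dimension \<open>d\<close>, \<open>N\<^sub>n\<close> the dimension numbers, \<open>h\<close> the integral of the
  weight, and
  \<open>g(k; n, m) = N\<^sub>k / h * \<integral> P\<^sub>n P\<^sub>m P\<^sub>k (1 - t\<^sup>2) ^ e dt\<close>,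
  which by orthogonality is the coefficient of \<open>P\<^sub>k\<close> in the expansion of \<open>P\<^sub>n P\<^sub>m\<close>.

  The whole estimate rests on \<open>0 \<le> g(k; n, m) \<le> 1\<close>. Since \<open>h\<close> is the ratio of the two sphere
  areas, the squared singular value is
  \<open>\<mu>\<^sub>m\<^sup>2 / |S\<^sup>d\<^sup>-\<^sup>1| * (\<Sum>n. \<nu>\<^sub>n\<^sup>2 N\<^sub>n g(m + 1; l, n))\<close>,
  a sum of at most \<open>l + 1\<close> terms (\<open>card_odd_interval_le\<close>), and each of them is at most
  \<open>\<nu>\<^sub>n\<^sup>2 N\<^sub>n \<le> C\<^sub>d\<close>. Evaluating \<open>|S\<^sup>d\<^sup>-\<^sup>1|\<close> at odd \<open>d\<close> gives the first inequality, the second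
  one is \<open>2 (l + 1) \<le> 2 m + d\<close>, and the limit follows because the singular values are nonnegative.

  Bounds on \<open>g\<close>. The Rodrigues formula yields
  \<open>t P\<^sub>n = (1 - \<alpha>\<^sub>n) P\<^sub>n\<^sub>+\<^sub>1 + \<alpha>\<^sub>n P\<^sub>n\<^sub>-\<^sub>1\<close> with \<open>\<alpha>\<^sub>n = n / (2 n + d - 2)\<close>,
  and hence the three-term recurrences in \<open>n\<close> and in \<open>m\<close> that express \<open>\<integral> t P\<^sub>n P\<^sub>m P\<^sub>k\<close> agree.
  That is a discrete wave equation in \<open>(n, m)\<close>. After multiplication by \<open>N\<^sub>n N\<^sub>m\<close>, summing it over
  a backward light cone leaves only boundary terms, whose coefficients are nonnegative because
  \<open>\<alpha>\<close> is increasing and at most \<open>1/2\<close> (\<open>triangle_identity\<close>); as the initial values at \<open>m = 0\<close> are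
  nonnegative, so is the solution (\<open>hyperbolic_nonneg\<close>, \<open>triple_integral_nonneg\<close>). Summing the same
  equation over \<open>k\<close> shows \<open>(\<Sum>k. g(k; n, m)) = 1\<close> (\<open>sum_harm_dim_triple_integral\<close>), which reflects
  \<open>P\<^sub>k(1) = 1\<close>. Hence every \<open>g(k; n, m)\<close> is at most \<open>1\<close>.

  Bound on \<open>\<nu>\<^sub>n\<^sup>2 N\<^sub>n\<close>. The quotient of its values at \<open>n + 2\<close> and \<open>n\<close> is a ratio of cubic
  polynomials in \<open>n\<close> whose difference is \<open>(d - 2) (d - 4)\<close>. For \<open>d \<ge> 5\<close> the sequence over odd \<open>n\<close>
  is decreasing, with the value \<open>C\<^sub>d\<close> at \<open>n = 1\<close>; for \<open>d = 3\<close> it is increasing, and converges to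
  \<open>\<pi>\<close> by the product of Wallis (\<open>nu_sq_dim_le_C_const\<close>).\<close>

section \<open>A positivity principle for a discrete wave equation\<close>

text \<open>The equation \<open>\<alpha>(n+1) v(n+1,m) + (1 - \<alpha>(n-1)) v(n-1,m) = \<alpha>(m+1) v(n,m+1) + (1 - \<alpha>(m-1)) v(n,m-1)\<close>,
  with indices shifted to avoid subtraction, is summed over the triangle below the point \<open>(s + m, m)\<close>.
  In the interior all coefficients cancel; the two sums run over the left and the right edge.\<close>
lemma triangle_identity:
  fixes v :: "nat \<Rightarrow> nat \<Rightarrow> real" and \<alpha> :: "nat \<Rightarrow> real"
  assumes \<alpha>0: "\<alpha> 0 = 0"
    and rec0: "\<And>n. \<alpha> (n + 2) * v (n + 2) 0 + (1 - \<alpha> n) * v n 0 = \<alpha> 1 * v (n + 1) 1"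
    and rec: "\<And>n m. \<alpha> (n + 2) * v (n + 2) (m + 1) + (1 - \<alpha> n) * v n (m + 1)
                  = \<alpha> (m + 2) * v (n + 1) (m + 2) + (1 - \<alpha> m) * v (n + 1) m"
  shows "\<alpha> m * v (s + m) m
     = (\<Sum>j<m. (1 - \<alpha> (s + j) - \<alpha> j) * v (s + j) j)
       + (\<Sum>j<m. (\<alpha> (s + 2 * m - j) - \<alpha> j) * v (s + 2 * m - j) j)"
proof (induction m arbitrary: s rule: induct_nat_012)
  case 0
  show ?case by (simp add: \<alpha>0)
next
  case 1
  show ?case using rec0[of s] by (simp add: \<alpha>0 numeral_2_eq_2)
next
  case (ge2 m)
  \<comment> \<open>\<open>L s m\<close> and \<open>R t m\<close> are the lowest \<open>m\<close> terms on the lines \<open>i - j = s\<close> and \<open>i + j = t\<close> of points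
    \<open>(i, j)\<close>. The edges of the triangle below \<open>(s + m + 2, m + 2)\<close> prolong by one point
    the left edge of the triangle below \<open>(s + m + 1, m + 1)\<close> and the right edge of the one below
    \<open>(s + m + 3, m + 1)\<close>. The other edges of these two prolong, again by one point, those of the
    triangle below \<open>(s + m + 2, m)\<close>.\<close>
  define L where "L s m = (\<Sum>j<m. (1 - \<alpha> (s + j) - \<alpha> j) * v (s + j) j)" for s m
  define R where "R t m = (\<Sum>j<m. (\<alpha> (t - j) - \<alpha> j) * v (t - j) j)" for t m
  have a: "\<alpha> m * v (s + 2 + m) m = L (s + 2) m + R (s + 2 + 2 * m) m"
    using ge2(1)[of "s + 2"] by (simp only: L_def R_def)
  have b: "\<alpha> (Suc m) * v (s + Suc m) (Suc m) = L s (Suc m) + R (s + 2 * Suc m) (Suc m)"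
    using ge2(2)[of s] by (simp only: L_def R_def)
  have c: "\<alpha> (Suc m) * v (s + 2 + Suc m) (Suc m)
      = L (s + 2) (Suc m) + R (s + 2 + 2 * Suc m) (Suc m)"
    using ge2(2)[of "s + 2"] by (simp only: L_def R_def)
  have LS: "L s (Suc m) = L s m + (1 - \<alpha> (s + m) - \<alpha> m) * v (s + m) m" for s m
    by (simp add: L_def)
  have RS: "R t (Suc m) = R t m + (\<alpha> (t - m) - \<alpha> m) * v (t - m) m" for t m
    by (simp add: R_def)
  have e: "s + 2 + 2 * m - m = s + 2 + m" "s + 2 + 2 * Suc m - Suc m = s + m + 3" by auto
  have r: "\<alpha> (s + m + 3) * v (s + m + 3) (m + 1) + (1 - \<alpha> (s + m + 1)) * v (s + m + 1) (m + 1)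
      = \<alpha> (m + 2) * v (s + m + 2) (m + 2) + (1 - \<alpha> m) * v (s + m + 2) m"
    using rec[of "s + m + 1" m] by (simp add: algebra_simps numeral_eq_Suc)
  have "L s (Suc (Suc m)) + R (s + 2 + 2 * Suc m) (Suc (Suc m))
      = L s (Suc m) + (1 - \<alpha> (s + m + 1) - \<alpha> (Suc m)) * v (s + m + 1) (Suc m)
        + R (s + 2 + 2 * Suc m) (Suc m) + (\<alpha> (s + m + 3) - \<alpha> (Suc m)) * v (s + m + 3) (Suc m)"
    unfolding LS[of s "Suc m"] RS[of _ "Suc m"] e by simp
  moreover have "R (s + 2 + 2 * m) (Suc m)
      = R (s + 2 + 2 * m) m + (\<alpha> (s + 2 + m) - \<alpha> m) * v (s + 2 + m) m"
    unfolding RS[of _ m] e by simp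
  ultimately show ?case
    using a b c r LS[of "s + 2" m]
    unfolding L_def[symmetric] R_def[symmetric]
    by (simp add: algebra_simps numeral_eq_Suc)
qed

text \<open>The solution is nonnegative at all points \<open>(n, m)\<close> on one side of the diagonal (\<open>n \<ge> m\<close>) if it is so at \<open>m = 0\<close>.\<close>
lemma hyperbolic_nonneg:
  fixes v :: "nat \<Rightarrow> nat \<Rightarrow> real" and \<alpha> :: "nat \<Rightarrow> real"
  assumes "\<alpha> 0 = 0" and pos: "\<And>n. n > 0 \<Longrightarrow> \<alpha> n > 0"
    and "mono \<alpha>" and half: "\<And>n. \<alpha> n \<le> 1/2"
    and init: "\<And>n. v n 0 \<ge> 0"
    and "\<And>n. \<alpha> (n + 2) * v (n + 2) 0 + (1 - \<alpha> n) * v n 0 = \<alpha> 1 * v (n + 1) 1"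
    and "\<And>n m. \<alpha> (n + 2) * v (n + 2) (m + 1) + (1 - \<alpha> n) * v n (m + 1)
                  = \<alpha> (m + 2) * v (n + 1) (m + 2) + (1 - \<alpha> m) * v (n + 1) m"
  shows "v (s + m) m \<ge> 0"
proof (induction m arbitrary: s rule: less_induct)
  case (less m)
  show ?case
  proof (cases "m = 0")
    case False
    have "(1 - \<alpha> (s + j) - \<alpha> j) * v (s + j) j \<ge> 0" if "j < m" for j
      using less.IH[OF that] half[of j] half[of "s + j"] by (intro mult_nonneg_nonneg) auto
    moreover have "(\<alpha> (s + 2 * m - j) - \<alpha> j) * v (s + 2 * m - j) j \<ge> 0" if "j < m" for j
    proof (intro mult_nonneg_nonneg)
      show "0 \<le> \<alpha> (s + 2 * m - j) - \<alpha> j" using that by (simp add: monoD[OF \<open>mono \<alpha>\<close>])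
      have "s + 2 * m - j = (s + 2 * (m - j)) + j" using that by simp
      then show "0 \<le> v (s + 2 * m - j) j" using less.IH[OF that] by metis
    qed
    ultimately have "\<alpha> m * v (s + m) m \<ge> 0"
      unfolding triangle_identity[of \<alpha> v, OF assms(1,6,7)]
      by (intro add_nonneg_nonneg sum_nonneg) auto
    with pos[of m] False show ?thesis by (simp add: zero_le_mult_iff)
  qed (use init in simp)
qed

section \<open>Legendre polynomials in odd dimension\<close>

text \<open>The Legendre polynomial of degree \<open>n\<close> in dimension \<open>2 * e + 3\<close>, through its three-term recurrence.\<close>
fun legendre_pol :: "nat \<Rightarrow> nat \<Rightarrow> real poly" where
  "legendre_pol e 0 = 1"
| "legendre_pol e (Suc 0) = [:0, 1:]"
| "legendre_pol e (Suc (Suc n)) = smult (1 / real (n + 2 * e + 2))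
     (smult (real (2 * n + 2 * e + 3)) ([:0, 1:] * legendre_pol e (Suc n))
      - smult (real (n + 1)) (legendre_pol e n))"

text \<open>The coefficient of \<open>P\<^sub>n\<^sub>-\<^sub>1\<close> in \<open>t P\<^sub>n\<close>; that of \<open>P\<^sub>n\<^sub>+\<^sub>1\<close> is its complement to \<open>1\<close>.\<close>
definition lower_coeff :: "nat \<Rightarrow> nat \<Rightarrow> real" where
  "lower_coeff e n = real n / real (2 * n + 2 * e + 1)"

text \<open>Integration against the weight for which the polynomials of dimension \<open>2 * e + 3\<close> are orthogonal.\<close>
definition weight_integral :: "nat \<Rightarrow> real poly \<Rightarrow> real" where
  "weight_integral e p = integral {-1..1} (\<lambda>t. poly p t * (1 - t\<^sup>2) ^ e)"

lemma lower_coeff_0 [simp]: "lower_coeff e 0 = 0"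
  by (simp add: lower_coeff_def)

lemma lower_coeff_pos: "n > 0 \<Longrightarrow> lower_coeff e n > 0"
  by (simp add: lower_coeff_def)

lemma mono_lower_coeff: "mono (lower_coeff e)"
proof (rule monoI)
  fix m n :: nat
  assume "m \<le> n"
  then have "real m * real (2 * e + 1) \<le> real n * real (2 * e + 1)" by (intro mult_right_mono) auto
  then show "lower_coeff e m \<le> lower_coeff e n"
    by (simp add: lower_coeff_def divide_simps algebra_simps)
qed

lemma lower_coeff_le_half: "lower_coeff e n \<le> 1/2"
  by (simp add: lower_coeff_def divide_simps)

text \<open>For \<open>n = 0\<close> the term of index \<open>n - 1\<close>, where the subtraction truncates, has the coefficient zero.\<close>
lemma X_times_legendre:
  "[:0, 1:] * legendre_pol e n
     = smult (1 - lower_coeff e n) (legendre_pol e (n + 1)) + smult (lower_coeff e n) (legendre_pol e (n - 1))"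
proof (cases n)
  case (Suc k)
  have "1 - lower_coeff e n = real (k + 2 * e + 2) / real (2 * k + 2 * e + 3)"
    by (simp add: lower_coeff_def Suc divide_simps)
  moreover have "lower_coeff e n = real (k + 1) / real (2 * k + 2 * e + 3)"
    by (simp add: lower_coeff_def Suc)
  ultimately show ?thesis
    by (simp add: Suc smult_diff_right del: of_nat_add of_nat_mult mult_pCons_left)
qed simp

lemma poly_times_weight_integrable: "(\<lambda>t. poly p t * (1 - t\<^sup>2) ^ e) integrable_on {-1..1::real}"
  by (intro integrable_continuous_real continuous_intros)

lemma weight_integral_add: "weight_integral e (p + q) = weight_integral e p + weight_integral e q"
  unfolding weight_integral_def
  by (simp add: distrib_right integral_add poly_times_weight_integrable)

lemma weight_integral_smult: "weight_integral e (smult c p) = c * weight_integral e p"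
  unfolding weight_integral_def by (simp add: mult.assoc)

section \<open>The Rodrigues formula\<close>

lemma integral_pderiv:
  fixes p :: "real poly"
  assumes "a \<le> b"
  shows "integral {a..b} (poly (pderiv p)) = poly p b - poly p a"
proof (rule integral_unique, rule fundamental_theorem_of_calculus[OF assms])
  show "(poly p has_vector_derivative poly (pderiv p) x) (at x within {a..b})" for x
    unfolding has_real_derivative_iff_has_vector_derivative[symmetric]
    using poly_DERIV has_field_derivative_at_within by blast
qed

lemma higher_pderiv_X_mult:
  fixes p :: "real poly"
  shows "(pderiv ^^ n) ([:0, 1:] * p)
      = [:0, 1:] * (pderiv ^^ n) p + smult (real n) ((pderiv ^^ (n - 1)) p)"
proof (induction n)
  case (Suc n)
  show ?case
  proof (cases n)
    case (Suc k)
    define q where "q = (pderiv ^^ k) p"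
    have "(pderiv ^^ Suc n) ([:0, 1:] * p) = pderiv ([:0, 1:] * pderiv q + smult (real n) q)"
      using Suc.IH by (simp add: Suc q_def)
    also have "\<dots> = [:0, 1:] * pderiv (pderiv q) + (smult 1 (pderiv q) + smult (real n) (pderiv q))"
      by (simp add: pderiv_add pderiv_smult pderiv_pCons)
    also have "smult 1 (pderiv q) + smult (real n) (pderiv q) = smult (real (Suc n)) (pderiv q)"
      by (simp only: smult_add_left[symmetric] of_nat_Suc)
    finally show ?thesis by (simp add: Suc q_def)
  qed (simp add: pderiv_mult pderiv_pCons)
qed simp

lemma higher_pderiv_smult: "(pderiv ^^ n) (smult c p) = smult c ((pderiv ^^ n) (p :: real poly))"
  by (induction n) (simp_all add: pderiv_smult)

lemma higher_pderiv_add: "(pderiv ^^ n) (p + q) = (pderiv ^^ n) p + (pderiv ^^ n) (q :: real poly)"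
  by (induction n) (simp_all add: pderiv_add)

text \<open>The derivative of order \<open>n\<close> of \<open>(1 - t\<^sup>2) ^ (n + e)\<close>.\<close>
definition rodrigues :: "nat \<Rightarrow> nat \<Rightarrow> real poly" where
  "rodrigues e n = (pderiv ^^ n) ([:1, 0, -1:] ^ (n + e))"

text \<open>For \<open>n > 0\<close> the derivative of order \<open>n - 1\<close> of the same power, an antiderivative of
  \<open>rodrigues e n\<close>. At \<open>n = 0\<close> it only occurs with the factor zero.\<close>
definition rodrigues_prim :: "nat \<Rightarrow> nat \<Rightarrow> real poly" where
  "rodrigues_prim e n = (pderiv ^^ (n - 1)) ([:1, 0, -1:] ^ (n + e))"

lemma pderiv_rodrigues_prim: "n > 0 \<Longrightarrow> pderiv (rodrigues_prim e n) = rodrigues e n"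
  unfolding rodrigues_def rodrigues_prim_def by (cases n) auto

lemma pderiv_one_minus_sq_power:
  "pderiv ([:1, 0, -1:] ^ Suc a) = smult (- 2 * real (a + 1)) ([:0, 1:] * [:1, 0, -1:] ^ a :: real poly)"
proof -
  have "pderiv [:1, 0, -1::real:] = smult (-2) [:0, 1:]" by (simp add: pderiv_pCons)
  then show ?thesis unfolding pderiv_power_Suc by (simp only: mult_smult_left mult_smult_right smult_smult) (simp add: mult.commute)
qed

text \<open>This and the next lemma form a first-order system for \<open>rodrigues\<close> and \<open>rodrigues_prim\<close>, and
  eliminating the latter gives the three-term recurrence.\<close>
lemma rodrigues_Suc:
  "rodrigues e (Suc n) = smult (- 2 * real (n + e + 1))
     ([:0, 1:] * rodrigues e n + smult (real n) (rodrigues_prim e n))"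
proof -
  have "rodrigues e (Suc n) = (pderiv ^^ n) (pderiv ([:1, 0, -1:] ^ Suc (n + e)))"
    unfolding rodrigues_def by (simp add: funpow_swap1)
  then show ?thesis
    unfolding pderiv_one_minus_sq_power higher_pderiv_smult higher_pderiv_X_mult rodrigues_def rodrigues_prim_def .
qed

lemma rodrigues_prim_Suc:
  "smult (real (n + 2 * e + 2)) (rodrigues_prim e (Suc n))
     = smult (2 * real (n + e + 1)) ([:1, 0, -1:] * rodrigues e n - smult (real n) ([:0, 1:] * rodrigues_prim e n))"
proof (cases n)
  case 0
  then show ?thesis by (simp add: rodrigues_def rodrigues_prim_def algebra_simps)
next
  case (Suc k)
  define \<phi> :: "real poly" where "\<phi> = [:1, 0, -1:]"
  define X :: "real poly" where "X = [:0, 1:]"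
  define a where "a = real (n + e + 1)"
  \<comment> \<open>\<open>Z\<close> is the term of lower order. It is eliminated between two evaluations of the derivative of order
    \<open>n\<close> of \<open>\<phi> ^ (n + e + 1)\<close>: differentiating once first, and splitting off one factor \<open>\<phi>\<close>.\<close>
  define Z where "Z = smult (real k) ((pderiv ^^ (k - 1)) (\<phi> ^ (n + e)))"
  have A: "rodrigues e n = (pderiv ^^ n) (\<phi> ^ (n + e))"
    by (simp add: rodrigues_def \<phi>_def)
  have B: "rodrigues_prim e n = (pderiv ^^ k) (\<phi> ^ (n + e))"
    by (simp add: rodrigues_prim_def \<phi>_def Suc)
  have phi: "\<phi> = 1 + smult (-1) (X * X)" by (simp add: \<phi>_def X_def one_pCons)
  have B1: "rodrigues_prim e (Suc n) = (pderiv ^^ n) (\<phi> ^ Suc (n + e))"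
    by (simp add: rodrigues_prim_def \<phi>_def)
  have leib: "(pderiv ^^ j) (X * p) = X * (pderiv ^^ j) p + smult (real j) ((pderiv ^^ (j - 1)) p)" for j p
    unfolding X_def by (rule higher_pderiv_X_mult)
  have "(pderiv ^^ n) (\<phi> ^ Suc (n + e)) = (pderiv ^^ k) (pderiv (\<phi> ^ Suc (n + e)))"
    unfolding Suc by (simp add: funpow_swap1)
  also have "\<dots> = smult (- 2 * a) (X * rodrigues_prim e n + Z)"
    unfolding \<phi>_def pderiv_one_minus_sq_power higher_pderiv_smult a_def
    unfolding \<phi>_def[symmetric] X_def[symmetric] leib B Z_def by simp
  finally have 1: "rodrigues_prim e (Suc n) = smult (- 2 * a) (X * rodrigues_prim e n + Z)"
    using B1 by simp
  have "\<phi> ^ Suc (n + e) = \<phi> ^ (n + e) + smult (-1) (X * (X * \<phi> ^ (n + e)))"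
    unfolding power_Suc by (subst (1) phi) (simp add: algebra_simps)
  then have 2: "rodrigues_prim e (Suc n) = rodrigues e n
      + smult (-1) (X * (X * rodrigues e n + smult (real n) (rodrigues_prim e n))
                    + smult (real n) (X * rodrigues_prim e n + Z))"
    unfolding B1 A B Z_def by (simp only: higher_pderiv_add higher_pderiv_smult leib) (simp add: Suc)
  have "poly (smult (real (n + 2 * e + 2)) (rodrigues_prim e (Suc n))) t
      = poly (smult (2 * a) (\<phi> * rodrigues e n - smult (real n) (X * rodrigues_prim e n))) t" for t
  proof -
    have e1: "poly (rodrigues_prim e (Suc n)) t = - 2 * a * (poly X t * poly (rodrigues_prim e n) t + poly Z t)"
      by (subst 1) simp
    have e2: "poly (rodrigues_prim e (Suc n)) t = poly \<phi> t * poly (rodrigues e n) t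
        - 2 * real n * (poly X t * poly (rodrigues_prim e n) t) - real n * poly Z t"
      by (subst 2) (simp add: \<phi>_def X_def algebra_simps)
    have "real (n + 2 * e + 2) = 2 * a - real n" by (simp add: a_def)
    then have "poly (smult (real (n + 2 * e + 2)) (rodrigues_prim e (Suc n))) t
       = 2 * a * poly (rodrigues_prim e (Suc n)) t - real n * poly (rodrigues_prim e (Suc n)) t"
      by (simp add: left_diff_distrib del: of_nat_add)
    also have "\<dots> = poly (smult (2 * a) (\<phi> * rodrigues e n - smult (real n) (X * rodrigues_prim e n))) t"
      by (subst e2, subst e1) (simp add: algebra_simps)
    finally show ?thesis .
  qed
  then show ?thesis unfolding a_def \<phi>_def X_def by (simp add: poly_eq_poly_eq_iff[symmetric] fun_eq_iff)
qed

lemma poly_rodrigues_prim_end: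
  assumes "t\<^sup>2 = 1" "n > 0"
  shows "poly (rodrigues_prim e n) t = 0"
  using assms(2)
proof (induction n rule: nat_induct_non_zero)
  case 1
  then show ?case using assms(1) by (simp add: rodrigues_prim_def power2_eq_square)
next
  case (Suc n)
  have "real (n + 2 * e + 2) * poly (rodrigues_prim e (Suc n)) t = 0"
    using arg_cong[OF rodrigues_prim_Suc[of n e], of "\<lambda>p. poly p t"] Suc assms(1)
    by (simp add: power2_eq_square)
  then show ?case by simp
qed

lemma rodrigues_three_term:
  "smult (- real (n + 2 * e + 2)) (rodrigues e (n + 2))
     = smult (2 * real (n + e + 2)) (smult (real (2 * n + 2 * e + 3)) ([:0, 1:] * rodrigues e (n + 1))
         + smult (2 * real (n + e + 1) * real (n + 1)) (rodrigues e n))"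
proof -
  have "poly (smult (- real (n + 2 * e + 2)) (rodrigues e (n + 2))) t =
    poly (smult (2 * real (n + e + 2)) (smult (real (2 * n + 2 * e + 3)) ([:0, 1:] * rodrigues e (n + 1))
         + smult (2 * real (n + e + 1) * real (n + 1)) (rodrigues e n))) t" for t
  proof -
    define a0 a1 a2 b0 b1 where "a0 = poly (rodrigues e n) t" and "a1 = poly (rodrigues e (n+1)) t"
      and "a2 = poly (rodrigues e (n+2)) t" and "b0 = poly (rodrigues_prim e n) t" and "b1 = poly (rodrigues_prim e (n+1)) t"
    define x y where "x = real n" and "y = real e"
    have 1: "a1 = - 2 * (x + y + 1) * (t * a0 + x * b0)"
      unfolding a1_def a0_def b0_def x_def y_def using arg_cong[OF rodrigues_Suc[of e n], of "\<lambda>p. poly p t"] by simp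
    have 2: "a2 = - 2 * (x + y + 2) * (t * a1 + (x + 1) * b1)"
      unfolding a2_def a1_def b1_def x_def y_def using arg_cong[OF rodrigues_Suc[of e "Suc n"], of "\<lambda>p. poly p t"]
      by (simp add: algebra_simps)
    have 3: "(x + 2 * y + 2) * b1 = 2 * (x + y + 1) * ((1 - t * t) * a0 - x * (t * b0))"
      unfolding a0_def b0_def b1_def x_def y_def using arg_cong[OF rodrigues_prim_Suc[of n e], of "\<lambda>p. poly p t"]
      by (simp add: algebra_simps)
    have "(x + 2 * y + 2) * a2 = - 2 * (x + y + 2) * ((x + 2 * y + 2) * t * a1 + (x + 1) * ((x + 2 * y + 2) * b1))"
      unfolding 2 by (simp add: algebra_simps)
    also have "\<dots> = - 2 * (x + y + 2) * ((2 * x + 2 * y + 3) * t * a1 + (x + 1) * 2 * (x + y + 1) * a0)"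
      unfolding 3 1 by algebra
    finally have "- (x + 2 * y + 2) * a2 = 2 * (x + y + 2) * ((2 * x + 2 * y + 3) * t * a1 + 2 * (x + y + 1) * (x + 1) * a0)"
      by (simp add: algebra_simps)
    then show ?thesis
      unfolding a0_def a1_def a2_def x_def y_def by (simp add: algebra_simps)
  qed
  then show ?thesis by (simp add: poly_eq_poly_eq_iff[symmetric] fun_eq_iff)
qed

lemma double_fact_pos [simp]: "double_fact n > 0"
  by (induction n rule: double_fact.induct) auto

lemma rodrigues_eq_legendre:
  "rodrigues e n = smult ((- 1) ^ n * real (double_fact (2 * n + 2 * e)) / real (double_fact (2 * e)))
      ([:1, 0, -1:] ^ e * legendre_pol e n)"
proof (induction n rule: induct_nat_012)
  case 0
  show ?case using double_fact_pos[of "2 * e"] by (simp add: rodrigues_def)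
next
  case 1
  have "rodrigues e (Suc 0) = smult (- 2 - 2 * real e) ([:0, 1:] * [:1, 0, -1:] ^ e)"
    unfolding rodrigues_Suc by (simp add: rodrigues_def rodrigues_prim_def)
  moreover have "2 * Suc 0 + 2 * e = Suc (Suc (2 * e))" by simp
  then have "(- 1) ^ Suc 0 * real (double_fact (2 * Suc 0 + 2 * e)) / real (double_fact (2 * e)) = - 2 - 2 * real e"
    using double_fact_pos[of "2 * e"] by (simp only: double_fact.simps) (simp add: field_simps del: double_fact_pos)
  ultimately show ?case by (simp only: legendre_pol.simps mult.commute)
next
  case (ge2 n)
  define D :: "nat \<Rightarrow> real" where "D k = real (double_fact (2 * k + 2 * e)) / real (double_fact (2 * e))" for k
  have DS: "D (Suc k) = 2 * real (k + e + 1) * D k" for k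
  proof -
    have "2 * Suc k + 2 * e = Suc (Suc (2 * k + 2 * e))" by simp
    then have "double_fact (2 * Suc k + 2 * e) = (2 * k + 2 * e + 2) * double_fact (2 * k + 2 * e)"
      by (simp only: double_fact.simps) simp
    then show ?thesis by (simp add: D_def algebra_simps)
  qed
  have "poly (rodrigues e (Suc (Suc n))) t =
     poly (smult ((- 1) ^ Suc (Suc n) * D (Suc (Suc n))) ([:1, 0, -1:] ^ e * legendre_pol e (Suc (Suc n)))) t" for t
  proof -
    define r where "r = poly (rodrigues e (Suc (Suc n))) t"
    define w where "w = poly ([:1, 0, -1:] ^ e) t"
    define p0 p1 where "p0 = poly (legendre_pol e n) t" and "p1 = poly (legendre_pol e (Suc n)) t"
    define s :: real where "s = (-1) ^ n"
    define x y where "x = real n" and "y = real e"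
    have pos: "x + 2 * y + 2 > 0" by (simp add: x_def y_def)
    have 0: "poly (rodrigues e n) t = s * D n * (w * p0)"
      using arg_cong[OF ge2(1), of "\<lambda>p. poly p t"] by (simp add: D_def s_def w_def p0_def)
    have 1: "poly (rodrigues e (Suc n)) t = - s * (2 * (x + y + 1) * D n) * (w * p1)"
      using arg_cong[OF ge2(2), of "\<lambda>p. poly p t"]
      unfolding times_divide_eq_right[symmetric] D_def[symmetric] DS poly_smult poly_mult w_def[symmetric] p1_def[symmetric]
      by (simp add: s_def x_def y_def)
    have 2: "poly (legendre_pol e (Suc (Suc n))) t = ((2 * x + 2 * y + 3) * (t * p1) - (x + 1) * p0) / (x + 2 * y + 2)"
      by (simp add: x_def y_def p0_def p1_def algebra_simps diff_divide_distrib add_divide_distrib)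
    have "- (x + 2 * y + 2) * r = 2 * (x + y + 2) * ((2 * x + 2 * y + 3) * (t * (poly (rodrigues e (Suc n)) t))
         + 2 * (x + y + 1) * (x + 1) * poly (rodrigues e n) t)"
      using arg_cong[OF rodrigues_three_term[of n e], of "\<lambda>p. poly p t"]
      by (simp add: x_def y_def r_def algebra_simps)
    also have "\<dots> = - (x + 2 * y + 2) * (s * (2 * (x + y + 2)) * (2 * (x + y + 1)) * D n * w *
       (((2 * x + 2 * y + 3) * (t * p1) - (x + 1) * p0) / (x + 2 * y + 2)))"
      unfolding 0 1 using pos by (simp add: field_simps)
    finally have "r = s * (2 * (x + y + 2)) * (2 * (x + y + 1)) * D n * w * poly (legendre_pol e (Suc (Suc n))) t"
      unfolding 2 using pos by (subst (asm) mult_cancel_left) auto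
    then show ?thesis
      unfolding r_def[symmetric] poly_smult poly_mult w_def[symmetric] DS
      by (simp add: s_def x_def y_def algebra_simps del: legendre_pol.simps)
  qed
  then show ?case unfolding D_def by (simp add: poly_eq_poly_eq_iff[symmetric] fun_eq_iff mult.assoc del: legendre_pol.simps)
qed

text \<open>The weighted polynomial is a derivative, and its antiderivative vanishes at both end points.\<close>
lemma weight_integral_legendre:
  assumes "n > 0"
  shows "weight_integral e (legendre_pol e n) = 0"
proof -
  define c where "c = (- 1) ^ n * real (double_fact (2 * n + 2 * e)) / real (double_fact (2 * e))"
  have c: "c \<noteq> 0" using double_fact_pos[of "2 * e"] double_fact_pos[of "2 * n + 2 * e"]
    by (simp add: c_def del: double_fact_pos)
  have "integral {-1..1} (poly (rodrigues e n)) = poly (rodrigues_prim e n) 1 - poly (rodrigues_prim e n) (-1)"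
    using integral_pderiv[of "-1" 1 "rodrigues_prim e n"] pderiv_rodrigues_prim[OF assms] by simp
  also have "\<dots> = 0" using assms by (simp add: poly_rodrigues_prim_end)
  finally have "integral {-1..1} (poly (rodrigues e n)) = 0" .
  moreover have "poly (rodrigues e n) = (\<lambda>t. c * (poly (legendre_pol e n) t * (1 - t\<^sup>2) ^ e))"
    unfolding rodrigues_eq_legendre c_def[symmetric] by (auto simp: poly_power power2_eq_square algebra_simps)
  ultimately show ?thesis using c by (simp add: weight_integral_def)
qed


lemma higher_deriv_eq_poly:
  fixes f :: "real \<Rightarrow> real"
  assumes "open S" "\<And>s. s \<in> S \<Longrightarrow> f s = poly p s" "t \<in> S"
  shows "(deriv ^^ n) f t = poly ((pderiv ^^ n) p) t"
  using assms(3)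
proof (induction n arbitrary: t)
  case (Suc n)
  have "((deriv ^^ n) f has_field_derivative poly (pderiv ((pderiv ^^ n) p)) t) (at t)"
    by (rule has_field_derivative_transform_within_open[OF poly_DERIV assms(1) Suc.prems])
       (use Suc.IH in simp)
  then show ?case by (simp add: DERIV_imp_deriv)
qed (use assms(2) in simp)

lemma legendre_dim_eq_poly:
  assumes "- 1 < t" "t < 1"
  shows "legendre_dim n (2 * e + 3) t = poly (legendre_pol e n) t"
proof -
  have sq: "1 - s\<^sup>2 > 0" if "s \<in> {-1<..<1}" for s :: real
    using that by (simp add: abs_square_less_1 abs_less_iff)
  have t: "t \<in> {-1<..<1}" using assms by simp
  have "(1 - s\<^sup>2) powr (real n + (real (2 * e + 3) - 3) / 2) = poly ([:1, 0, -1:] ^ (n + e)) s"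
    if "s \<in> {-1<..<1}" for s :: real
  proof -
    have "real n + (real (2 * e + 3) - 3) / 2 = real (n + e)" by simp
    then show ?thesis using sq[OF that] by (simp only: powr_realpow) (simp add: power2_eq_square)
  qed
  then have D: "(deriv ^^ n) (\<lambda>s. (1 - s\<^sup>2) powr (real n + (real (2 * e + 3) - 3) / 2)) t = poly (rodrigues e n) t"
    unfolding rodrigues_def by (intro higher_deriv_eq_poly[OF _ _ t]) auto
  have "(3 - real (2 * e + 3)) / 2 = - real e" by simp
  then have P: "(1 - t\<^sup>2) powr ((3 - real (2 * e + 3)) / 2) = inverse ((1 - t\<^sup>2) ^ e)"
    using sq[OF t] by (simp only: powr_minus powr_realpow)
  have "poly (rodrigues e n) t = (- 1) ^ n * real (double_fact (2 * n + 2 * e)) / real (double_fact (2 * e))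
      * ((1 - t\<^sup>2) ^ e * poly (legendre_pol e n) t)"
    unfolding rodrigues_eq_legendre by (simp add: power2_eq_square)
  moreover have "(1 - t\<^sup>2) ^ e \<noteq> 0" using sq[OF t] by simp
  moreover have "2 * e + 3 - 3 = 2 * e" "2 * n + (2 * e + 3) - 3 = 2 * n + 2 * e" by auto
  ultimately show ?thesis
    unfolding legendre_dim_def D P
    using double_fact_pos[of "2 * e"] double_fact_pos[of "2 * n + 2 * e"]
    by (simp add: field_simps del: double_fact_pos)
qed

section \<open>Orthogonality and triple products\<close>

lemma harm_dim_odd:
  "harm_dim n (2 * e + 3) = real (2 * n + 2 * e + 1) * fact (n + 2 * e) / (fact n * fact (2 * e + 1))"
  by (simp add: harm_dim_def)

lemma harm_dim_pos: "harm_dim n (2 * e + 3) > 0"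
  unfolding harm_dim_odd by simp

lemma harm_dim_0: "harm_dim 0 (2 * e + 3) = 1"
proof -
  have "fact (2 * e + 1) = real (2 * e + 1) * fact (2 * e)" by simp
  then show ?thesis unfolding harm_dim_odd by (simp only:) simp
qed

lemma harm_dim_balance:
  "harm_dim n (2 * e + 3) * (1 - lower_coeff e n) = harm_dim (n + 1) (2 * e + 3) * lower_coeff e (n + 1)"
proof -
  have "1 - lower_coeff e n = real (n + 2 * e + 1) / real (2 * n + 2 * e + 1)"
    by (simp add: lower_coeff_def field_simps)
  then have "harm_dim n (2 * e + 3) * (1 - lower_coeff e n)
      = real (n + 2 * e + 1) * fact (n + 2 * e) / (fact n * fact (2 * e + 1))"
    unfolding harm_dim_odd by (simp del: of_nat_add of_nat_mult fact_Suc)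
  also have "real (n + 2 * e + 1) * fact (n + 2 * e) = (fact (n + 1 + 2 * e) :: real)"
    by simp
  also have "fact (n + 1 + 2 * e) / (fact n * fact (2 * e + 1)) = harm_dim (n + 1) (2 * e + 3) * lower_coeff e (n + 1)"
  proof -
    have "fact (n + 1) = real (n + 1) * fact n" by simp
    moreover have "real (2 * (n + 1) + 2 * e + 1) \<noteq> 0" "real (n + 1) \<noteq> 0" by simp_all
    ultimately show ?thesis
      unfolding harm_dim_odd lower_coeff_def by (simp only:) (simp del: of_nat_add of_nat_Suc of_nat_mult)
  qed
  finally show ?thesis .
qed

lemma weight_integral_X_legendre:
  "weight_integral e ([:0, 1:] * legendre_pol e n * q)
     = (1 - lower_coeff e n) * weight_integral e (legendre_pol e (n + 1) * q)
       + lower_coeff e n * weight_integral e (legendre_pol e (n - 1) * q)"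
  unfolding X_times_legendre distrib_right mult_smult_left weight_integral_add weight_integral_smult ..

text \<open>Both sides satisfy the recurrence that comes from the symmetry of \<open>\<integral> t P\<^sub>n P\<^sub>k\<close>, and they agree
  at \<open>k = 0\<close>.\<close>
lemma legendre_orthogonal:
  "harm_dim n (2 * e + 3) * weight_integral e (legendre_pol e n * legendre_pol e k)
     = (if n = k then weight_integral e 1 else 0)"
proof (induction k arbitrary: n rule: less_induct)
  case (less k)
  define N where "N n = harm_dim n (2 * e + 3)" for n
  define \<alpha> where "\<alpha> = lower_coeff e"
  define J where "J n k = weight_integral e (legendre_pol e n * legendre_pol e k)" for n k
  define h where "h = weight_integral e 1"
  have bal: "N n * (1 - \<alpha> n) = N (n + 1) * \<alpha> (n + 1)" for n
    unfolding N_def \<alpha>_def by (rule harm_dim_balance)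
  have X: "(1 - \<alpha> n) * J (n + 1) k + \<alpha> n * J (n - 1) k = (1 - \<alpha> k) * J n (k + 1) + \<alpha> k * J n (k - 1)" for n k
    using weight_integral_X_legendre[of e n "legendre_pol e k"] weight_integral_X_legendre[of e k "legendre_pol e n"]
    unfolding \<alpha>_def J_def by (simp only: mult_ac)
  have IH: "N n * J n j = (if n = j then h else 0)" if "j < k" for n j
    using less.IH[OF that] unfolding N_def J_def h_def .
  show ?case
  proof (cases k)
    case 0
    then show ?thesis using weight_integral_legendre[of n e] harm_dim_0[of e] by simp
  next
    case (Suc i)
    \<comment> \<open>Truncated subtraction is harmless: \<open>\<alpha>\<close> vanishes at zero.\<close>
    have down: "N n * \<alpha> n * J (n - 1) i = (if n = Suc i then (1 - \<alpha> i) * h else 0)"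
    proof (cases n)
      case (Suc n')
      have "N n * \<alpha> n * J (n - 1) i = (1 - \<alpha> n') * (N n' * J n' i)"
        using bal[of n'] Suc by (simp add: mult_ac)
      then show ?thesis using IH[of i n'] \<open>k = Suc i\<close> Suc by simp
    qed (simp add: \<alpha>_def)
    have up: "N n * (1 - \<alpha> n) * J (n + 1) i = (if n + 1 = i then \<alpha> i * h else 0)"
    proof -
      have "N n * (1 - \<alpha> n) * J (n + 1) i = \<alpha> (n + 1) * (N (n + 1) * J (n + 1) i)"
        unfolding bal by (simp only: mult_ac)
      also have "N (n + 1) * J (n + 1) i = (if n + 1 = i then h else 0)"
        using IH[of i "n + 1"] Suc by simp
      finally show ?thesis by simp
    qed
    have low: "N n * (\<alpha> i * J n (i - 1)) = (if n + 1 = i then \<alpha> i * h else 0)"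
      using IH[of "i - 1" n] Suc by (cases i) (auto simp: \<alpha>_def)
    have "(1 - \<alpha> i) * (N n * J n (Suc i)) = N n * ((1 - \<alpha> i) * J n (i + 1) + \<alpha> i * J n (i - 1)) - N n * (\<alpha> i * J n (i - 1))"
      by (simp add: algebra_simps)
    also have "\<dots> = N n * (1 - \<alpha> n) * J (n + 1) i + N n * \<alpha> n * J (n - 1) i - N n * (\<alpha> i * J n (i - 1))"
      unfolding X[symmetric] by (simp add: algebra_simps)
    also have "\<dots> = (1 - \<alpha> i) * (if n = k then h else 0)"
      unfolding up down low Suc by simp
    finally have "(1 - \<alpha> i) * (N n * J n k) = (1 - \<alpha> i) * (if n = k then h else 0)" by (simp add: Suc)
    moreover have "1 - \<alpha> i \<noteq> 0" using lower_coeff_le_half[of e i] by (simp add: \<alpha>_def)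
    ultimately show ?thesis unfolding N_def J_def h_def by (simp only: mult_cancel_left) auto
  qed
qed

text \<open>Up to the factor \<open>N\<^sub>k / h\<close> this is the coefficient of \<open>P\<^sub>k\<close> in the expansion of \<open>P\<^sub>n P\<^sub>m\<close>.\<close>
definition triple_integral :: "nat \<Rightarrow> nat \<Rightarrow> nat \<Rightarrow> nat \<Rightarrow> real" where
  "triple_integral e n m k = weight_integral e (legendre_pol e n * legendre_pol e m * legendre_pol e k)"

lemma triple_integral_commute: "triple_integral e n m k = triple_integral e m n k"
  by (simp add: triple_integral_def mult.commute)

lemma triple_integral_rec:
  "(1 - lower_coeff e n) * triple_integral e (n + 1) m k + lower_coeff e n * triple_integral e (n - 1) m k
   = (1 - lower_coeff e m) * triple_integral e n (m + 1) k + lower_coeff e m * triple_integral e n (m - 1) k"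
  using weight_integral_X_legendre[of e n "legendre_pol e m * legendre_pol e k"]
    weight_integral_X_legendre[of e m "legendre_pol e n * legendre_pol e k"]
  unfolding triple_integral_def by (simp only: mult_ac)

text \<open>Integrating the derivative of \<open>t (1 - t\<^sup>2) ^ (e + 1)\<close> relates the values at \<open>e\<close> and \<open>e + 1\<close>.\<close>
lemma weight_integral_1:
  "weight_integral e 1 = 2 ^ (e + 1) * fact e / real (double_fact (2 * e + 1))"
proof (induction e)
  case 0
  show ?case by (simp add: weight_integral_def)
next
  case (Suc e)
  have ds: "double_fact (2 * Suc e + 1) = (2 * e + 3) * double_fact (2 * e + 1)"
    by (simp add: algebra_simps)
  have "((\<lambda>t. t * (1 - t\<^sup>2) ^ (e + 1)) has_real_derivative
      real (2 * e + 3) * (1 - t\<^sup>2) ^ (e + 1) - real (2 * e + 2) * (1 - t\<^sup>2) ^ e) (at t within {-1..1})" for t :: real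
  proof -
    have "((\<lambda>t. t * (1 - t\<^sup>2) ^ (e + 1)) has_real_derivative
       (1 - t\<^sup>2) ^ (e + 1) + t * (real (e + 1) * (1 - t\<^sup>2) ^ e * (- (2 * t)))) (at t within {-1..1})"
    proof -
      have "((\<lambda>t. 1 - t\<^sup>2) has_real_derivative - (2 * t)) (at t within {-1..1})"
        by (auto intro!: derivative_eq_intros)
      from DERIV_mult[OF DERIV_ident DERIV_power_Suc[OF this, of e]]
      show ?thesis by (simp add: mult_ac add.commute)
    qed
    moreover have "(1 - t\<^sup>2) ^ (e + 1) + t * (real (e + 1) * (1 - t\<^sup>2) ^ e * (- (2 * t)))
       = real (2 * e + 3) * (1 - t\<^sup>2) ^ (e + 1) - real (2 * e + 2) * (1 - t\<^sup>2) ^ e"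
      by (simp add: algebra_simps power2_eq_square)
    ultimately show ?thesis by simp
  qed
  then have "((\<lambda>t. real (2 * e + 3) * (1 - t\<^sup>2) ^ (e + 1) - real (2 * e + 2) * (1 - t\<^sup>2) ^ e) has_integral
      1 * (1 - 1\<^sup>2) ^ (e + 1) - (- 1) * (1 - (- 1)\<^sup>2) ^ (e + 1)) {- 1..1::real}"
    by (intro fundamental_theorem_of_calculus) (auto simp: has_real_derivative_iff_has_vector_derivative[symmetric])
  moreover have "((\<lambda>t. real (2 * e + 3) * (1 - t\<^sup>2) ^ (e + 1) - real (2 * e + 2) * (1 - t\<^sup>2) ^ e) has_integral
      real (2 * e + 3) * weight_integral (Suc e) 1 - real (2 * e + 2) * weight_integral e 1) {- 1..1::real}"
    unfolding weight_integral_def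
    using poly_times_weight_integrable[of 1 e] poly_times_weight_integrable[of 1 "Suc e"]
    by (intro has_integral_diff has_integral_mult_right integrable_integral) (simp_all add: integrable_integral)
  ultimately have "real (2 * e + 3) * weight_integral (Suc e) 1 = real (2 * e + 2) * weight_integral e 1"
    by (auto dest: has_integral_unique)
  then have "weight_integral (Suc e) 1 = real (2 * e + 2) * weight_integral e 1 / real (2 * e + 3)"
    by (simp add: field_simps)
  then show ?case
    unfolding Suc.IH ds by (simp add: field_simps)
qed

lemma weight_integral_1_pos: "weight_integral e 1 > 0"
  unfolding weight_integral_1 by simp

lemma harm_dim_triple_integral_0:
  "harm_dim k (2 * e + 3) * triple_integral e n 0 k = (if n = k then weight_integral e 1 else 0)"
  using legendre_orthogonal[of k e n] by (auto simp: triple_integral_def mult.commute)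

lemma triple_integral_nonneg: "triple_integral e n m k \<ge> 0"
proof -
  define N where "N n = harm_dim n (2 * e + 3)" for n
  define \<alpha> where "\<alpha> = lower_coeff e"
  \<comment> \<open>With this normalisation \<open>harm_dim_balance\<close> turns the recurrence into the one for which the
    triangle sums have no interior terms.\<close>
  define v where "v n m = N n * N m * triple_integral e n m k" for n m
  have bal: "N n * (1 - \<alpha> n) = N (n + 1) * \<alpha> (n + 1)" for n
    unfolding N_def \<alpha>_def by (rule harm_dim_balance)
  have Npos: "N n > 0" for n unfolding N_def by (rule harm_dim_pos)
  have up: "N n * N m * ((1 - \<alpha> n) * triple_integral e (n + 1) m k) = \<alpha> (n + 1) * v (n + 1) m" for n m
    using bal[of n] by (simp add: v_def mult_ac)
  have down: "N (n + 1) * N m * (\<alpha> (n + 1) * triple_integral e n m k) = (1 - \<alpha> n) * v n m" for n m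
    using bal[of n] by (simp add: v_def mult_ac)
  have sym: "v n m = v m n" for n m
    unfolding v_def by (simp add: triple_integral_commute[of e n m] mult_ac)
  have rec: "\<alpha> (n + 2) * v (n + 2) (m + 1) + (1 - \<alpha> n) * v n (m + 1)
      = \<alpha> (m + 2) * v (n + 1) (m + 2) + (1 - \<alpha> m) * v (n + 1) m" for n m
    using arg_cong[OF triple_integral_rec[of e "n + 1" "m + 1" k], of "\<lambda>x. N (n + 1) * N (m + 1) * x"]
      up[of "n + 1" "m + 1"] down[of n "m + 1"] up[of "m + 1" "n + 1"] down[of m "n + 1"]
    unfolding sym[of "n + 1"] triple_integral_commute[of e "n + 1"] \<alpha>_def[symmetric] distrib_left
    by (simp add: mult.commute[of "N (Suc m)"])
  have rec0: "\<alpha> (n + 2) * v (n + 2) 0 + (1 - \<alpha> n) * v n 0 = \<alpha> 1 * v (n + 1) 1" for n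
    using arg_cong[OF triple_integral_rec[of e "n + 1" 0 k], of "\<lambda>x. N (n + 1) * N 0 * x"]
      up[of "n + 1" 0] down[of n 0] up[of 0 "n + 1"]
    unfolding sym[of "n + 1"] triple_integral_commute[of e "n + 1"] \<alpha>_def[symmetric] distrib_left
    by (simp add: mult.commute[of "N 0"] \<alpha>_def)
  have init: "v n 0 \<ge> 0" for n
  proof -
    have "N k * triple_integral e n 0 k \<ge> 0"
      using harm_dim_triple_integral_0[of k e n] weight_integral_1_pos[of e] by (simp add: N_def)
    then have "triple_integral e n 0 k \<ge> 0"
      using Npos[of k] by (simp add: zero_le_mult_iff)
    then show ?thesis using Npos[of n] Npos[of 0] by (simp add: v_def)
  qed
  have "v (s + m) m \<ge> 0" for s m
    using hyperbolic_nonneg[of \<alpha> v, OF _ _ _ _ init rec0 rec]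
      lower_coeff_0[of e] lower_coeff_pos[of _ e] mono_lower_coeff[of e] lower_coeff_le_half[of e]
    unfolding \<alpha>_def by blast
  then have "v (n - m + m) m \<ge> 0" "v (m - n + n) n \<ge> 0" by blast+
  then have "v n m \<ge> 0"
    using sym[of m n] by (cases "m \<le> n") simp_all
  then show ?thesis
    using mult_pos_pos[OF Npos[of n] Npos[of m]]
    unfolding v_def zero_le_mult_iff[of "N n * N m"] by linarith
qed

text \<open>The coefficients of \<open>P\<^sub>n P\<^sub>m\<close> add up to \<open>1\<close>; those with \<open>k > n + m\<close> vanish.\<close>
lemma sum_harm_dim_triple_integral:
  "n + m \<le> K \<Longrightarrow> (\<Sum>k\<le>K. harm_dim k (2 * e + 3) * triple_integral e n m k) = weight_integral e 1"
proof (induction m arbitrary: n rule: less_induct)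
  case (less m)
  define G where "G n m = (\<Sum>k\<le>K. harm_dim k (2 * e + 3) * triple_integral e n m k)" for n m
  define h where "h = weight_integral e 1"
  define \<alpha> where "\<alpha> = lower_coeff e"
  have rec: "(1 - \<alpha> n) * G (n + 1) m + \<alpha> n * G (n - 1) m = (1 - \<alpha> m) * G n (m + 1) + \<alpha> m * G n (m - 1)" for n m
  proof -
    have "(\<Sum>k\<le>K. harm_dim k (2 * e + 3) *
        ((1 - \<alpha> n) * triple_integral e (n + 1) m k + \<alpha> n * triple_integral e (n - 1) m k))
      = (\<Sum>k\<le>K. harm_dim k (2 * e + 3) *
        ((1 - \<alpha> m) * triple_integral e n (m + 1) k + \<alpha> m * triple_integral e n (m - 1) k))"
      unfolding \<alpha>_def triple_integral_rec ..
    then show ?thesis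
      unfolding G_def by (simp add: sum_distrib_left sum.distrib distrib_left mult.left_commute)
  qed
  have IH: "G i j = h" if "j < m" "i + j \<le> K" for i j
    using less.IH[OF that] by (simp add: G_def h_def)
  have "G n m = h"
  proof (cases m)
    case 0
    then show ?thesis using less.prems by (simp add: G_def harm_dim_triple_integral_0 h_def)
  next
    case (Suc i)
    have "G (n + 1) i = h" "G (n - 1) i = h" using IH[of i] Suc less.prems by auto
    moreover have "\<alpha> i * G n (i - 1) = \<alpha> i * h"
      using IH[of "i - 1" n] Suc less.prems by (cases i) (auto simp: \<alpha>_def)
    ultimately have "(1 - \<alpha> n) * h + \<alpha> n * h = (1 - \<alpha> i) * G n (i + 1) + \<alpha> i * h"
      using rec[of n i] by (simp only:)
    then have "(1 - \<alpha> i) * G n (i + 1) = (1 - \<alpha> i) * h"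
      by (simp add: algebra_simps)
    moreover have "1 - \<alpha> i \<noteq> 0" using lower_coeff_le_half[of e i] by (simp add: \<alpha>_def)
    ultimately show ?thesis using Suc by simp
  qed
  then show ?case by (simp add: G_def h_def)
qed

lemma harm_dim_triple_integral_le:
  "harm_dim k (2 * e + 3) * triple_integral e n m k \<le> weight_integral e 1"
proof -
  have "harm_dim k (2 * e + 3) * triple_integral e n m k
      \<le> (\<Sum>k\<le>n + m + k. harm_dim k (2 * e + 3) * triple_integral e n m k)"
    by (rule member_le_sum) (auto intro!: mult_nonneg_nonneg triple_integral_nonneg less_imp_le[OF harm_dim_pos])
  then show ?thesis by (simp add: sum_harm_dim_triple_integral)
qed


section \<open>Sphere areas\<close>

lemma Gamma_half_odd:
  "Gamma (real e + 3 / 2) = real (double_fact (2 * e + 1)) * sqrt pi / 2 ^ (e + 1)"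
proof (induction e)
  case 0
  have "(1 / 2 :: real) \<notin> \<int>\<^sub>\<le>\<^sub>0" by (auto dest: nonpos_Ints_nonpos)
  then show ?case using Gamma_plus1[of "1 / 2 :: real"] by (simp add: Gamma_one_half_real)
next
  case (Suc e)
  have "real e + 3 / 2 \<notin> \<int>\<^sub>\<le>\<^sub>0" by (auto dest: nonpos_Ints_nonpos)
  then have "Gamma (real (Suc e) + 3 / 2) = (real e + 3 / 2) * Gamma (real e + 3 / 2)"
    using Gamma_plus1[of "real e + 3 / 2"] by (simp add: algebra_simps)
  moreover have "double_fact (2 * Suc e + 1) = (2 * e + 3) * double_fact (2 * e + 1)"
    by (simp add: algebra_simps)
  ultimately show ?case unfolding Suc.IH by (simp add: field_simps)
qed

lemma sphere_area_even: "sphere_area (2 * e + 2) = 2 ^ (e + 2) * pi ^ (e + 1) / real (double_fact (2 * e + 1))"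
proof -
  have 1: "(real (2 * e + 2) + 1) / 2 = real e + 3 / 2" by simp
  have "pi powr (real e + 3 / 2) = pi powr (real (e + 1) + 1 / 2)" by (simp add: add.commute)
  also have "\<dots> = pi ^ (e + 1) * sqrt pi"
    unfolding powr_add by (simp add: powr_realpow powr_half_sqrt del: of_nat_add of_nat_Suc)
  finally show ?thesis unfolding sphere_area_def 1 Gamma_half_odd by (simp add: field_simps)
qed

lemma sphere_area_ratio: "sphere_area (2 * e + 2) = weight_integral e 1 * sphere_area (2 * e + 1)"
proof -
  have 1: "(real (2 * e + 1) + 1) / 2 = real (e + 1)" by simp
  have 2: "Gamma (real (e + 1)) = fact e" using Gamma_fact[of e, where ?'a = real] by (simp add: add.commute)
  have "sphere_area (2 * e + 1) = 2 * pi ^ (e + 1) / fact e"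
    unfolding sphere_area_def 1 2 by (subst powr_realpow) auto
  then show ?thesis unfolding sphere_area_even weight_integral_1 by simp
qed

section \<open>A sharp bound for \<open>\<nu>\<^sub>n\<^sup>2 N\<^sub>n\<close>\<close>

text \<open>The factor \<open>\<nu>\<^sub>n\<^sup>2 N\<^sub>n\<close> in dimension \<open>2 * e + 3\<close>, indexed by \<open>k\<close> where \<open>n = 2 * k + 1\<close>.\<close>
definition nu_sq_dim :: "nat \<Rightarrow> nat \<Rightarrow> real" where
  "nu_sq_dim e k = (nu (2 * k + 1) (2 * e + 3))\<^sup>2 * harm_dim (2 * k + 1) (2 * e + 3)"

lemma nu_sq: "(nu (2 * k + 1) (2 * e + 3))\<^sup>2 = (real (double_fact (2 * k)) / real (double_fact (2 * k + 2 * e + 1)))\<^sup>2"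
  by (simp add: nu_def power_divide power_mult_distrib flip: power_mult)

lemma nu_sq_dim_pos: "nu_sq_dim e k > 0"
  unfolding nu_sq_dim_def nu_sq by (intro mult_pos_pos harm_dim_pos) simp

lemma nu_sq_dim_Suc:
  "nu_sq_dim e (Suc k) * (real (4 * k + 2 * e + 3) * real (2 * k + 3) * real (2 * k + 2 * e + 3))
    = nu_sq_dim e k * (real (4 * k + 2 * e + 7) * real (2 * k + 2) * real (2 * k + 2 * e + 2))"
proof -
  define a b c f g where "a = real (double_fact (2 * k))" and "b = real (double_fact (2 * k + 2 * e + 1))"
    and "c = real (2 * k + 2)" and "f = (fact (2 * k + 1 + 2 * e) :: real)" and "g = (fact (2 * k + 1) :: real)"
  define x y where "x = real k" and "y = real e"
  have pos: "b > 0" "f > 0" "g > 0" by (simp_all add: b_def f_def g_def)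
  have xy: "x \<ge> 0" "y \<ge> 0" by (simp_all add: x_def y_def)
  have e1: "2 * Suc k = Suc (Suc (2 * k))" "2 * Suc k + 2 * e + 1 = Suc (Suc (2 * k + 2 * e + 1))" by simp_all
  have 1: "real (double_fact (2 * Suc k)) = (2 * x + 2) * a"
    unfolding e1 by (simp add: a_def x_def algebra_simps)
  have 2: "real (double_fact (2 * Suc k + 2 * e + 1)) = (2 * x + 2 * y + 3) * b"
    unfolding e1 by (simp add: b_def x_def y_def algebra_simps)
  have 3: "(fact (2 * Suc k + 1) :: real) = (2 * x + 3) * ((2 * x + 2) * g)"
    by (simp add: g_def x_def algebra_simps)
  have "2 * Suc k + 1 + 2 * e = Suc (Suc (2 * k + 1 + 2 * e))" by simp
  then have 4: "(fact (2 * Suc k + 1 + 2 * e) :: real) = (2 * x + 2 * y + 3) * ((2 * x + 2 * y + 2) * f)"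
    by (simp only: fact_Suc) (simp add: f_def x_def y_def algebra_simps)
  have E0: "nu_sq_dim e k = (a / b)\<^sup>2 * ((4 * x + 2 * y + 3) * f / (g * fact (2 * e + 1)))"
    unfolding nu_sq_dim_def nu_sq harm_dim_odd a_def b_def f_def g_def x_def y_def by simp
  have E1: "nu_sq_dim e (Suc k) = ((2 * x + 2) * a / ((2 * x + 2 * y + 3) * b))\<^sup>2 * ((4 * x + 2 * y + 7)
      * ((2 * x + 2 * y + 3) * ((2 * x + 2 * y + 2) * f)) / (((2 * x + 3) * ((2 * x + 2) * g)) * fact (2 * e + 1)))"
    unfolding nu_sq_dim_def nu_sq harm_dim_odd 1 2 3 4 by (simp add: x_def y_def)
  define G where "G = (fact (2 * e + 1) :: real)"
  define p q r where "p = 2 * x + 2" and "q = 2 * x + 2 * y + 3" and "r = 2 * x + 3"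
  have nz: "b \<noteq> 0" "g \<noteq> 0" "G \<noteq> 0" "p \<noteq> 0" "q \<noteq> 0" "r \<noteq> 0"
    using pos xy by (auto simp: p_def q_def r_def G_def)
  have R: "real (4 * k + 2 * e + 3) = 4 * x + 2 * y + 3" "real (2 * k + 3) = r"
    "real (2 * k + 2 * e + 3) = q" "real (4 * k + 2 * e + 7) = 4 * x + 2 * y + 7"
    "real (2 * k + 2) = p" "real (2 * k + 2 * e + 2) = 2 * x + 2 * y + 2"
    by (simp_all add: x_def y_def p_def q_def r_def)
  show ?thesis
    unfolding E0 E1 R G_def[symmetric] p_def[symmetric] q_def[symmetric] r_def[symmetric]
    using nz by (simp add: power2_eq_square) (simp only: mult_ac)
qed

lemma double_fact_eq_wallis:
  "(real (double_fact (2 * k)) / real (double_fact (2 * k + 1)))\<^sup>2 * real (2 * k + 1)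
     = (\<Prod>j=1..k. (4 * real j ^ 2) / (4 * real j ^ 2 - 1))"
proof (induction k)
  case (Suc k)
  define a b x where "a = real (double_fact (2 * k))" and "b = real (double_fact (2 * k + 1))" and "x = real k"
  have pos: "b > 0" "x \<ge> 0" by (simp_all add: b_def x_def)
  have 1: "real (double_fact (2 * Suc k)) = (2 * x + 2) * a" by (simp add: a_def x_def algebra_simps)
  have 2: "real (double_fact (2 * Suc k + 1)) = (2 * x + 3) * b" by (simp add: b_def x_def algebra_simps)
  have "4 * real (Suc k) ^ 2 = (2 * x + 2)\<^sup>2" "4 * real (Suc k) ^ 2 - 1 = (2 * x + 1) * (2 * x + 3)"
    by (simp_all add: x_def power2_eq_square algebra_simps)
  then have "(\<Prod>j=1..Suc k. (4 * real j ^ 2) / (4 * real j ^ 2 - 1))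
      = (\<Prod>j=1..k. (4 * real j ^ 2) / (4 * real j ^ 2 - 1)) * ((2 * x + 2)\<^sup>2 / ((2 * x + 1) * (2 * x + 3)))"
    by simp
  also have "\<dots> = ((a / b)\<^sup>2 * (2 * x + 1)) * ((2 * x + 2)\<^sup>2 / ((2 * x + 1) * (2 * x + 3)))"
    using Suc.IH by (simp only: a_def b_def x_def of_nat_add of_nat_mult of_nat_numeral of_nat_1)
  also have "\<dots> = ((2 * x + 2) * a / ((2 * x + 3) * b))\<^sup>2 * (2 * x + 3)"
    using pos by (simp add: power_divide power_mult_distrib power2_eq_square[of "2 * x + 3"])
      (simp only: mult_ac)
  finally show ?case unfolding 1 2 by (simp add: x_def)
qed simp

lemma nu_sq_dim_0_tendsto: "nu_sq_dim 0 \<longlonglongrightarrow> pi"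
proof -
  have eq: "nu_sq_dim 0 k = (\<Prod>j=1..k. (4 * real j ^ 2) / (4 * real j ^ 2 - 1)) * (2 + inverse (real (Suc (2 * k))))" for k
  proof -
    have "(2 + inverse (real (Suc (2 * k)))) * real (2 * k + 1) = 4 * real k + 3"
      by (simp add: field_simps)
    moreover have "harm_dim (2 * k + 1) (2 * 0 + 3) = 4 * real k + 3"
      unfolding harm_dim_odd by simp
    ultimately show ?thesis
      unfolding double_fact_eq_wallis[symmetric] nu_sq_dim_def nu_sq by (simp only: mult.assoc) (simp add: mult.commute)
  qed
  have "strict_mono (\<lambda>k::nat. 2 * k)" by (simp add: strict_mono_def)
  from LIMSEQ_subseq_LIMSEQ[OF LIMSEQ_inverse_real_of_nat this]
  have "(\<lambda>k. 2 + inverse (real (Suc (2 * k)))) \<longlonglongrightarrow> 2 + 0"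
    unfolding o_def by (intro tendsto_add tendsto_const)
  from tendsto_mult[OF wallis this] show ?thesis by (simp only: eq[symmetric] add_0_right) simp
qed

text \<open>Decreasing from the value \<open>C_const\<close> at \<open>k = 0\<close> for \<open>d \<ge> 5\<close>, increasing to the limit \<open>\<pi>\<close> for \<open>d = 3\<close>.\<close>
lemma nu_sq_dim_le_C_const: "nu_sq_dim e k \<le> C_const (2 * e + 3)"
proof (cases "e = 0")
  case False
  have "nu_sq_dim e (Suc k) \<le> nu_sq_dim e k" for k
  proof -
    define x y where "x = real k" and "y = real e"
    have xy: "x \<ge> 0" "y \<ge> 1" using False by (simp_all add: x_def y_def)
    have "(4 * x + 2 * y + 3) * (2 * x + 3) * (2 * x + 2 * y + 3) - (4 * x + 2 * y + 7) * (2 * x + 2) * (2 * x + 2 * y + 2)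
        = (2 * y + 1) * (2 * y - 1)"
      by (simp add: algebra_simps)
    moreover have "(2 * y + 1) * (2 * y - 1) \<ge> 0" using xy by simp
    ultimately have le: "real (4 * k + 2 * e + 7) * real (2 * k + 2) * real (2 * k + 2 * e + 2)
        \<le> real (4 * k + 2 * e + 3) * real (2 * k + 3) * real (2 * k + 2 * e + 3)"
      by (simp add: x_def y_def algebra_simps)
    have "nu_sq_dim e (Suc k) * (real (4 * k + 2 * e + 3) * real (2 * k + 3) * real (2 * k + 2 * e + 3))
       \<le> nu_sq_dim e k * (real (4 * k + 2 * e + 3) * real (2 * k + 3) * real (2 * k + 2 * e + 3))"
      unfolding nu_sq_dim_Suc by (rule mult_left_mono[OF le less_imp_le[OF nu_sq_dim_pos]])
    then show ?thesis by (rule mult_right_le_imp_le) simp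
  qed
  then have "nu_sq_dim e k \<le> nu_sq_dim e 0"
    by (rule lift_Suc_antimono_le[of "nu_sq_dim e"]) simp
  also have "nu_sq_dim e 0 = C_const (2 * e + 3)"
  proof -
    have "harm_dim 1 (2 * e + 3) = real (2 * e + 3)"
      proof -
      have "fact (1 + 2 * e) = (fact (2 * e + 1) :: real)" by (simp only: add.commute)
      then show ?thesis unfolding harm_dim_odd by (simp only:) simp
    qed
    then show ?thesis
      using False nu_sq[of 0 e] unfolding nu_sq_dim_def C_const_def by (simp add: power_divide)
  qed
  finally show ?thesis .
next
  case True
  have "nu_sq_dim 0 k \<le> nu_sq_dim 0 (Suc k)" for k
  proof -
    define x where "x = real k"
    have "(4 * x + 7) * (2 * x + 2) * (2 * x + 2) - (4 * x + 3) * (2 * x + 3) * (2 * x + 3) = 1"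
      by (simp add: algebra_simps)
    then have le: "real (4 * k + 2 * 0 + 3) * real (2 * k + 3) * real (2 * k + 2 * 0 + 3)
         \<le> real (4 * k + 2 * 0 + 7) * real (2 * k + 2) * real (2 * k + 2 * 0 + 2)"
      by (simp add: x_def algebra_simps)
    have "nu_sq_dim 0 k * (real (4 * k + 2 * 0 + 3) * real (2 * k + 3) * real (2 * k + 2 * 0 + 3))
       \<le> nu_sq_dim 0 (Suc k) * (real (4 * k + 2 * 0 + 3) * real (2 * k + 3) * real (2 * k + 2 * 0 + 3))"
      unfolding nu_sq_dim_Suc by (rule mult_left_mono[OF le less_imp_le[OF nu_sq_dim_pos]])
    then show ?thesis by (rule mult_right_le_imp_le) simp
  qed
  then have "incseq (nu_sq_dim 0)" by (rule incseq_SucI)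
  then have "nu_sq_dim 0 k \<le> pi" by (rule incseq_le[OF _ nu_sq_dim_0_tendsto])
  then show ?thesis using True by (simp add: C_const_def)
qed

section \<open>The singular values\<close>

text \<open>The integrands may differ at the two end points, where the Rodrigues formula degenerates.\<close>
lemma integral_legendre_dim_eq:
  "integral {-1..1} (\<lambda>t. legendre_dim n (2 * e + 3) t * legendre_dim m (2 * e + 3) t
      * legendre_dim k (2 * e + 3) t * (1 - t\<^sup>2) powr ((real (2 * e + 3) - 3) / 2)) = triple_integral e n m k"
  unfolding triple_integral_def weight_integral_def
proof (rule integral_spike[where S = "{-1, 1}"])
  fix t :: real
  assume t: "t \<in> {-1..1} - {-1, 1}"
  then have "1 - t\<^sup>2 > 0" by (simp add: abs_square_less_1 abs_less_iff)
  moreover have "(real (2 * e + 3) - 3) / 2 = real e" by simp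
  ultimately have "(1 - t\<^sup>2) powr ((real (2 * e + 3) - 3) / 2) = (1 - t\<^sup>2) ^ e"
    by (simp only: powr_realpow)
  with t show "poly (legendre_pol e n * legendre_pol e m * legendre_pol e k) t * (1 - t\<^sup>2) ^ e
     = legendre_dim n (2 * e + 3) t * legendre_dim m (2 * e + 3) t
      * legendre_dim k (2 * e + 3) t * (1 - t\<^sup>2) powr ((real (2 * e + 3) - 3) / 2)"
    by (simp add: legendre_dim_eq_poly)
qed simp


text \<open>The last factor in the sum is the coefficient of \<open>P\<^sub>m\<^sub>+\<^sub>1\<close> in the expansion of \<open>P\<^sub>l P\<^sub>n\<close>.\<close>
lemma sing_val_eq:
  "sing_val m l (2 * e + 3) = sqrt (2 ^ (e + 2) * pi ^ (e + 1) * real (double_fact (2 * e + 1)) / real (2 * m + 2 * e + 3)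
     * (\<Sum>n | n \<in> {m + 1 - l..m + 1 + l} \<and> odd n.
          (nu n (2 * e + 3))\<^sup>2 * harm_dim n (2 * e + 3)
          * (harm_dim (m + 1) (2 * e + 3) * triple_integral e (m + 1) l n / weight_integral e 1)))"
proof -
  define I where "I = {n. n \<in> {m + 1 - l..m + 1 + l} \<and> odd n}"
  define b where "b n = (nu n (2 * e + 3))\<^sup>2 * harm_dim n (2 * e + 3)" for n
  define S h N where "S = sphere_area (2 * e + 1)" and "h = weight_integral e 1" and "N = harm_dim (m + 1) (2 * e + 3)"
  have h: "h > 0" unfolding h_def by (rule weight_integral_1_pos)
  have hS: "h * S = 2 ^ (e + 2) * pi ^ (e + 1) / real (double_fact (2 * e + 1))"
    unfolding h_def S_def sphere_area_ratio[symmetric] by (rule sphere_area_even)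
  then have "h * S > 0" by (simp only:) simp
  with h have S: "S > 0" by (simp add: zero_less_mult_iff)
  have mu: "(mu m (2 * e + 3))\<^sup>2 = (2 ^ (e + 2) * pi ^ (e + 1))\<^sup>2 / real (2 * m + 2 * e + 3)"
  proof -
    have "2 * e + 3 + 1 = (e + 2) * 2" "2 * e + 3 - 1 = (e + 1) * 2" by simp_all
    then have "(2 :: real) ^ (2 * e + 3 + 1) * pi ^ (2 * e + 3 - 1) = (2 ^ (e + 2) * pi ^ (e + 1))\<^sup>2"
      by (simp only: power_mult power_mult_distrib)
    then show ?thesis unfolding mu_def by (simp add: add.assoc)
  qed
  have "(mu m (2 * e + 3))\<^sup>2 / (h * S) = 2 ^ (e + 2) * pi ^ (e + 1) * real (double_fact (2 * e + 1)) / real (2 * m + 2 * e + 3)"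
  proof -
    have "x\<^sup>2 / M / (x / D) = x * D / M" if "x \<noteq> 0" for x M D :: real
      using that by (simp add: power2_eq_square)
    then show ?thesis unfolding hS mu by simp
  qed
  moreover have "N * (mu m (2 * e + 3))\<^sup>2 * S / (h * S)\<^sup>2 * (\<Sum>n\<in>I. b n * triple_integral e (m + 1) l n)
      = (mu m (2 * e + 3))\<^sup>2 / (h * S) * (\<Sum>n\<in>I. b n * (N * triple_integral e (m + 1) l n / h))"
  proof -
    have "(\<Sum>n\<in>I. b n * (N * triple_integral e (m + 1) l n / h)) = N / h * (\<Sum>n\<in>I. b n * triple_integral e (m + 1) l n)"
      unfolding sum_distrib_left by (intro sum.cong) (simp_all add: mult_ac)
    then show ?thesis using h S by (simp add: power2_eq_square) (simp only: mult_ac)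
  qed
  moreover have "2 * e + 3 - 2 = 2 * e + 1" "2 * e + 3 - 1 = 2 * e + 2" by simp_all
  ultimately show ?thesis
    unfolding sing_val_def integral_legendre_dim_eq
    by (simp only: I_def[symmetric] b_def[symmetric] N_def[symmetric] h_def[symmetric] S_def[symmetric] sphere_area_ratio)
qed

lemma nu_harm_dim_le:
  assumes "odd n"
  shows "(nu n (2 * e + 3))\<^sup>2 * harm_dim n (2 * e + 3) \<le> C_const (2 * e + 3)"
  using assms nu_sq_dim_le_C_const[of e] by (auto simp: nu_sq_dim_def elim!: oddE)

lemma C_const_pos: "d > 0 \<Longrightarrow> C_const d > 0"
  by (simp add: C_const_def)

lemma card_odd_interval_le:
  assumes "l \<le> m" "even (m + l)"
  shows "card {n. n \<in> {m + 1 - l..m + 1 + l} \<and> odd n} \<le> l + 1"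
proof -
  have "{n. n \<in> {m + 1 - l..m + 1 + l} \<and> odd n} \<subseteq> (\<lambda>i. m + 1 - l + 2 * i) ` {..l}"
  proof
    fix n assume n: "n \<in> {n. n \<in> {m + 1 - l..m + 1 + l} \<and> odd n}"
    then have "even (n - (m + 1 - l))" using assms by (auto simp: even_diff_nat)
    then obtain i where "n - (m + 1 - l) = 2 * i" by (elim evenE)
    with n assms show "n \<in> (\<lambda>i. m + 1 - l + 2 * i) ` {..l}" by (intro image_eqI[of _ _ i]) auto
  qed
  then have "card {n. n \<in> {m + 1 - l..m + 1 + l} \<and> odd n} \<le> card ((\<lambda>i. m + 1 - l + 2 * i) ` {..l})"
    by (intro card_mono) auto
  also have "\<dots> \<le> l + 1" using card_image_le[of "{..l}"] by simp
  finally show ?thesis .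
qed

lemma sing_val_nonneg: "sing_val m l (2 * e + 3) \<ge> 0"
  unfolding sing_val_eq
  by (intro real_sqrt_ge_zero mult_nonneg_nonneg sum_nonneg divide_nonneg_nonneg triple_integral_nonneg
        less_imp_le[OF harm_dim_pos] less_imp_le[OF weight_integral_1_pos]) auto

lemma sing_val_le:
  assumes "l \<le> m" "even (m + l)"
  shows "sing_val m l (2 * e + 3) \<le> sqrt (2 ^ (e + 2) * pi ^ (e + 1) * (C_const (2 * e + 3) * real (double_fact (2 * e + 1)))
     * ((real l + 1) / (2 * real m + real (2 * e + 3))))"
proof -
  define I where "I = {n. n \<in> {m + 1 - l..m + 1 + l} \<and> odd n}"
  define g where "g n = harm_dim (m + 1) (2 * e + 3) * triple_integral e (m + 1) l n / weight_integral e 1" for n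
  define C where "C = C_const (2 * e + 3)"
  have C: "C > 0" unfolding C_def by (rule C_const_pos) simp
  have g: "0 \<le> g n" "g n \<le> 1" for n
  proof -
    have "triple_integral e (m + 1) l n = triple_integral e l n (m + 1)"
      by (simp add: triple_integral_def mult_ac)
    then show "g n \<le> 1"
      using harm_dim_triple_integral_le[of "m + 1" e l n] weight_integral_1_pos[of e] by (simp add: g_def)
    show "0 \<le> g n" unfolding g_def
      by (intro divide_nonneg_nonneg mult_nonneg_nonneg triple_integral_nonneg
          less_imp_le[OF harm_dim_pos] less_imp_le[OF weight_integral_1_pos])
  qed
  have "(\<Sum>n\<in>I. (nu n (2 * e + 3))\<^sup>2 * harm_dim n (2 * e + 3) * g n) \<le> (\<Sum>n\<in>I. C * 1)"
    using nu_harm_dim_le g C by (intro sum_mono mult_mono) (auto simp: I_def C_def)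
  also have "\<dots> = real (card I) * C" by simp
  also have "\<dots> \<le> (real l + 1) * C"
    using card_odd_interval_le[OF assms] C unfolding I_def[symmetric] by (intro mult_right_mono) auto
  finally have "2 ^ (e + 2) * pi ^ (e + 1) * real (double_fact (2 * e + 1)) / real (2 * m + 2 * e + 3)
      * (\<Sum>n\<in>I. (nu n (2 * e + 3))\<^sup>2 * harm_dim n (2 * e + 3) * g n)
     \<le> 2 ^ (e + 2) * pi ^ (e + 1) * real (double_fact (2 * e + 1)) / real (2 * m + 2 * e + 3) * ((real l + 1) * C)"
    by (intro mult_left_mono) auto
  also have "\<dots> = 2 ^ (e + 2) * pi ^ (e + 1) * (C * real (double_fact (2 * e + 1)))
     * ((real l + 1) / (2 * real m + real (2 * e + 3)))"
    by (simp add: mult_ac add.assoc)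
  finally show ?thesis
    unfolding sing_val_eq I_def[symmetric] g_def[symmetric] C_def[symmetric] by (rule real_sqrt_le_mono)
qed

lemma powr_half_nat: "x > 0 \<Longrightarrow> x powr (real n / 2) = sqrt (x ^ n)" for x :: real
proof -
  assume x: "x > 0"
  have "x powr (real n / 2) = (x powr real n) powr (1 / 2)" by (simp add: powr_powr)
  also have "\<dots> = sqrt (x ^ n)" using x by (simp add: powr_realpow powr_half_sqrt)
  finally show ?thesis .
qed

theorem theorem4p7:
  fixes d :: nat
  assumes "d \<ge> 3" and "odd d"
  shows "(\<forall>m l. l \<le> m \<and> even (m + l) \<longrightarrow>
            sing_val m l d \<le> 2 powr ((real d + 1) / 4) * pi powr ((real d - 1) / 4)
              * sqrt (C_const d * real (double_fact (d - 2)))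
              * sqrt ((real l + 1) / (2 * real m + real d))
          \<and> 2 powr ((real d + 1) / 4) * pi powr ((real d - 1) / 4)
              * sqrt (C_const d * real (double_fact (d - 2)))
              * sqrt ((real l + 1) / (2 * real m + real d))
            \<le> (2 * pi) powr ((real d - 1) / 4) * sqrt (C_const d * real (double_fact (d - 2))))
       \<and> (\<forall>l. ((\<lambda>m. sing_val m l d) \<longlongrightarrow> 0) (inf sequentially (principal {m. even (m + l)})))"
proof -
  obtain e where d: "d = 2 * e + 3"
  proof -
    from assms have "even (d - 3)" by simp
    then obtain e where "d - 3 = 2 * e" by (elim evenE)
    with assms show ?thesis by (intro that[of e]) simp
  qed
  define K where "K = sqrt (C_const d * real (double_fact (d - 2)))"
  define B where "B m l = 2 powr ((real d + 1) / 4) * pi powr ((real d - 1) / 4) * K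
              * sqrt ((real l + 1) / (2 * real m + real d))" for m l
  have exps: "(real d + 1) / 4 = real (e + 2) / 2" "(real d - 1) / 4 = real (e + 1) / 2"
    by (simp_all add: d)
  have K: "K \<ge> 0" using C_const_pos[of d] assms by (simp add: K_def)
  have B_eq: "B m l = sqrt (2 ^ (e + 2) * pi ^ (e + 1) * (C_const d * real (double_fact (d - 2)))
     * ((real l + 1) / (2 * real m + real d)))" for m l
    unfolding B_def exps K_def powr_half_nat[OF pi_gt_zero] powr_half_nat[OF zero_less_numeral]
    by (simp only: real_sqrt_mult mult.assoc)
  have le_B: "sing_val m l d \<le> B m l" if "l \<le> m" "even (m + l)" for m l
    using sing_val_le[OF that, of e] unfolding B_eq by (simp add: d)
  have B_le: "B m l \<le> (2 * pi) powr ((real d - 1) / 4) * K" if "l \<le> m" for m l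
  proof -
    have "2 powr ((real d + 1) / 4) * sqrt ((real l + 1) / (2 * real m + real d))
        = sqrt (2 ^ (e + 1)) * sqrt (2 * ((real l + 1) / (2 * real m + real d)))"
      unfolding exps powr_half_nat[OF zero_less_numeral] by (simp flip: real_sqrt_mult)
    also have "\<dots> \<le> sqrt (2 ^ (e + 1)) * sqrt 1"
      using that by (intro mult_left_mono real_sqrt_le_mono) (auto simp: d divide_le_eq)
    also have "\<dots> = 2 powr ((real d - 1) / 4)" unfolding exps powr_half_nat[OF zero_less_numeral] by simp
    finally have "2 powr ((real d + 1) / 4) * sqrt ((real l + 1) / (2 * real m + real d)) * (pi powr ((real d - 1) / 4) * K)
       \<le> 2 powr ((real d - 1) / 4) * (pi powr ((real d - 1) / 4) * K)"
      using K by (intro mult_right_mono) auto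
    then show ?thesis unfolding B_def by (simp add: powr_mult mult_ac)
  qed
  have lim: "((\<lambda>m. sing_val m l d) \<longlongrightarrow> 0) (inf sequentially (principal {m. even (m + l)}))" for l
  proof (rule tendsto_sandwich[where f = "\<lambda>_. 0" and h = "\<lambda>m. B m l"])
    show "\<forall>\<^sub>F m in inf sequentially (principal {m. even (m + l)}). 0 \<le> sing_val m l d"
      using sing_val_nonneg by (simp add: d)
    have "\<forall>\<^sub>F m in sequentially. even (m + l) \<longrightarrow> sing_val m l d \<le> B m l"
      using eventually_ge_at_top[of l] by eventually_elim (use le_B in auto)
    then show "\<forall>\<^sub>F m in inf sequentially (principal {m. even (m + l)}). sing_val m l d \<le> B m l"
      by (simp add: eventually_inf_principal)
    have "filterlim (\<lambda>m. 2 * real m + real d) at_top sequentially"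
      by (rule filterlim_at_top_mono[OF filterlim_real_sequentially]) simp
    then have "(\<lambda>m. (real l + 1) / (2 * real m + real d)) \<longlonglongrightarrow> 0"
      by (rule real_tendsto_divide_at_top[OF tendsto_const])
    from tendsto_real_sqrt[OF this] have "(\<lambda>m. B m l) \<longlonglongrightarrow> 0"
      unfolding B_def by (auto intro: tendsto_mult_right_zero)
    then show "((\<lambda>m. B m l) \<longlongrightarrow> 0) (inf sequentially (principal {m. even (m + l)}))"
      by (rule tendsto_mono[OF inf_le1])
  qed simp
  show ?thesis
    unfolding K_def[symmetric] B_def[symmetric] using le_B B_le lim by blast
qed

end
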